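(* For $L$ and $M$ being non-negative integers, we have \begin{align*} \sum_{\substack{m\geq 0\\L\equiv m\ \text{(mod }2\text{)}}} q^{m^2 \mp m}{3M \brack m}_{q^2} {2M + \frac{L-m}{2}\brack 2M}_{q^6} &= \sum_{j=-\infty}^{\infty} q^{3j^2+j}\, \mathcal{T}_{\pm 1}\left(L,M;\,j,j;\,q^6\right). \end{align*}
   Context: Here $|q|<1$, $(a;q)_n=(1-a)(1-aq)\cdots(1-aq^{n-1})$, and ${m+n \brack m}_q = \frac{(q;q)_{m+n}}{(q;q)_m(q;q)_n}$ for $m,n\geq 0$ and $0$ otherwise. Define \[\mathcal{T}_{1}(L,M;\,a,b;\,q) := \sum_{\substack{n\geq0, \\ L-a\equiv n \text{ (mod 2)}}} q^{n\choose 2} {M\brack n}_q {M+b+\frac{L-a-n}{2} \brack M+b}_q {M-b +\frac{L+a-n}{2}\brack M-b}_q,\] \[\mathcal{T}_{-1}(L,M;\,a,b;\,q) := \sum_{\substack{n\geq0, \\ L-a\equiv n \text{ (mod 2)}}} q^{n+1\choose 2} {M\brack n}_q {M+b+\frac{L-a-n}{2} \brack M+b}_q {M-b +\frac{L+a-n}{2}\brack M-b}_q.\] Upper signs go together ($q^{m^2-m}$ with $\mathcal{T}_1$) and lower signs go together ($q^{m^2+m}$ with $\mathcal{T}_{-1}$). *)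

theory Defs
  imports "HOL-Analysis.Analysis" "HOL-Number_Theory.Cong"
begin

definition qpoch :: "complex \<Rightarrow> complex \<Rightarrow> nat \<Rightarrow> complex" where
  "qpoch a q n = (\<Prod>k<n. 1 - a * q ^ k)"

text \<open>
  \<open>qbinom q N k\<close> is the \<open>q\<close>-binomial coefficient with top \<open>N = m + n\<close> and bottom \<open>k = m\<close>;
  it vanishes unless \<open>m \<ge> 0\<close> and \<open>n = N - k \<ge> 0\<close>. Both entries are integers because
  bottom entries such as \<open>M - b\<close> and differences such as \<open>(L - a - n) / 2\<close> may be negative.
\<close>

definition qbinom :: "complex \<Rightarrow> int \<Rightarrow> int \<Rightarrow> complex" where
  "qbinom q N k =
     (if 0 \<le> k \<and> 0 \<le> N - k
      then qpoch q q (nat N) / (qpoch q q (nat k) * qpoch q q (nat (N - k)))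
      else 0)"

text \<open>
  In the summands below the integer divisions by \<open>2\<close> are exact: \<open>n\<close> is restricted by
  \<open>L - a \<equiv> n (mod 2)\<close>, and \<open>L + a\<close> has the same parity as \<open>L - a\<close>.
\<close>

definition T_plus :: "int \<Rightarrow> int \<Rightarrow> int \<Rightarrow> int \<Rightarrow> complex \<Rightarrow> complex" where
  "T_plus L M a b q =
     (\<Sum>\<^sub>\<infinity> n \<in> {n::nat. [L - a = int n] (mod 2)}.
        q ^ (n choose 2) * qbinom q M (int n)
        * qbinom q (M + b + (L - a - int n) div 2) (M + b)
        * qbinom q (M - b + (L + a - int n) div 2) (M - b))"

definition T_minus :: "int \<Rightarrow> int \<Rightarrow> int \<Rightarrow> int \<Rightarrow> complex \<Rightarrow> complex" where
  "T_minus L M a b q =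
     (\<Sum>\<^sub>\<infinity> n \<in> {n::nat. [L - a = int n] (mod 2)}.
        q ^ ((n + 1) choose 2) * qbinom q M (int n)
        * qbinom q (M + b + (L - a - int n) div 2) (M + b)
        * qbinom q (M - b + (L + a - int n) div 2) (M - b))"

text \<open>
  All sums involved have finite support, so no \<open>infsum\<close> takes its default value
  for non-summable families.
\<close>

lemma qbinom_eq_0: "k < 0 \<or> N < k \<Longrightarrow> qbinom q N k = 0"
  by (auto simp: qbinom_def)

lemma summable_on_finite_support:
  fixes f :: "'a \<Rightarrow> complex"
  assumes "finite B" and "\<And>x. x \<in> A - B \<Longrightarrow> f x = 0"
  shows "f summable_on A"
proof -
  have "f summable_on (A \<inter> B)"
    using assms(1) by (intro summable_on_finite) auto
  thus ?thesis
    by (rule summable_on_cong_neutral[THEN iffD1, rotated -1]) (use assms(2) in auto)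
qed

lemma summable_qbinom_lower:
  fixes f g :: "nat \<Rightarrow> complex" and M :: int
  shows "(\<lambda>n. f n * qbinom q M (int n) * g n) summable_on A"
  by (rule summable_on_finite_support[of "{..nat M}"]) (auto simp: qbinom_eq_0)

lemma T_plus_support: "\<bar>b\<bar> > M \<Longrightarrow> T_plus L M a b q = 0"
  unfolding T_plus_def by (intro infsum_0) (auto simp: qbinom_eq_0 abs_if split: if_splits)

lemma T_minus_support: "\<bar>b\<bar> > M \<Longrightarrow> T_minus L M a b q = 0"
  unfolding T_minus_def by (intro infsum_0) (auto simp: qbinom_eq_0 abs_if split: if_splits)

lemma summable_T_plus: "(\<lambda>j. f j * T_plus L M (a j) j q) summable_on A"
  by (rule summable_on_finite_support[of "{-M..M}"]) (auto intro!: T_plus_support)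

lemma summable_T_minus: "(\<lambda>j. f j * T_minus L M (a j) j q) summable_on A"
  by (rule summable_on_finite_support[of "{-M..M}"]) (auto intro!: T_minus_support)

end

theory Submission
  imports Defs "HOL-Computational_Algebra.Polynomial"
begin

text \<open>
  Put \<open>Q = q ^ 6\<close>. By the \<open>q\<close>-binomial theorem the coefficients \<open>q ^ (m\<^sup>2 - m) * [3M; m]\<close> (base \<open>q\<^sup>2\<close>)
  are those of \<open>\<Prod>k<3*M. 1 + q ^ (2*k) * t\<close>. Sorting the factors by \<open>k mod 3\<close> writes this polynomial
  as a product of three \<open>q\<close>-binomial expansions in base \<open>Q\<close>, with summation indices \<open>n, a, b\<close>. Collecting
  the terms with \<open>a - b = j\<close>, the factor with index \<open>n\<close> survives as the sum defining \<open>T\<close>, while the sum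
  over \<open>b\<close> is evaluated by the \<open>q\<close>-Saalschuetz summation. The other sign only replaces \<open>t\<close> by
  \<open>q\<^sup>2 * t\<close>, which changes the factor with index \<open>n\<close> and no other.
\<close>

section \<open>Gaussian binomials with natural entries\<close>

text \<open>Natural entries make induction and reindexing available. The explicit zero matters: for
  \<open>k > n\<close> the truncated \<open>n - k\<close> would otherwise give a nonzero
  quotient.\<close>

definition gauss_binom :: "complex \<Rightarrow> nat \<Rightarrow> nat \<Rightarrow> complex" where
  "gauss_binom q n k =
     (if k \<le> n then qpoch q q n / (qpoch q q k * qpoch q q (n - k)) else 0)"

lemma qbinom_int: "qbinom q (int n) (int k) = gauss_binom q n k"
  by (auto simp: qbinom_def gauss_binom_def nat_diff_distrib)

lemma one_minus_power_nonzero: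
  fixes q :: complex
  assumes "norm q < 1" "n > 0"
  shows "1 - q ^ n \<noteq> 0"
proof
  assume "1 - q ^ n = 0"
  hence "norm q ^ n = 1" by (metis eq_iff_diff_eq_0 norm_one norm_power)
  moreover have "norm q ^ n < 1"
    using assms by (simp add: power_less_one_iff)
  ultimately show False by simp
qed

lemma qpoch_Suc: "qpoch q q (Suc n) = qpoch q q n * (1 - q ^ Suc n)"
  by (simp add: qpoch_def)

lemma qpoch_nonzero: "norm q < 1 \<Longrightarrow> qpoch q q n \<noteq> 0"
proof (induction n)
  case (Suc n)
  thus ?case using one_minus_power_nonzero[of q "Suc n"] by (simp add: qpoch_Suc del: power_Suc)
qed (simp add: qpoch_def)

lemma gauss_binom_eq_0: "n < k \<Longrightarrow> gauss_binom q n k = 0"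
  by (simp add: gauss_binom_def)

lemma gauss_binom_0_right: "norm q < 1 \<Longrightarrow> gauss_binom q n 0 = 1"
  using qpoch_nonzero[of q n] by (simp add: gauss_binom_def qpoch_def)

lemma gauss_binom_same: "norm q < 1 \<Longrightarrow> gauss_binom q n n = 1"
  using qpoch_nonzero[of q n] by (simp add: gauss_binom_def qpoch_def)

lemma gauss_binom_symmetric: "k \<le> n \<Longrightarrow> gauss_binom q n (n - k) = gauss_binom q n k"
  by (simp add: gauss_binom_def mult.commute)

text \<open>One of the two \<open>q\<close>-Pascal rules. With x = q^(k+1) and y = q^(n-k) it comes
  from 1 - x*y = (1 - y) + y*(1 - x).\<close>

lemma gauss_binom_Suc_Suc:
  assumes "norm q < 1"
  shows "gauss_binom q (Suc n) (Suc k) =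
           gauss_binom q n (Suc k) + q ^ (n - k) * gauss_binom q n k"
proof (cases "k < n")
  case True
  then obtain d where n: "n = k + Suc d" using less_iff_Suc_add by auto
  have nz: "qpoch q q m \<noteq> 0" "1 - q ^ Suc m \<noteq> 0" for m
    using qpoch_nonzero[OF assms] one_minus_power_nonzero[OF assms] by blast+
  have alg: "(P * (1 - x * y)) / ((A * (1 - x)) * (B * (1 - y)))
      = P / ((A * (1 - x)) * B) + y * (P / (A * (B * (1 - y))))"
    if "A \<noteq> 0" "B \<noteq> 0" "1 - x \<noteq> 0" "1 - y \<noteq> 0" for A B x y P :: complex
    using that by (simp add: divide_simps) (simp add: algebra_simps)
  have pow: "q ^ Suc n = q ^ Suc k * q ^ Suc d"
    unfolding n by (simp add: power_add)
  have "gauss_binom q (Suc n) (Suc k) = (qpoch q q n * (1 - q ^ Suc n)) /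
      ((qpoch q q k * (1 - q ^ Suc k)) * (qpoch q q d * (1 - q ^ Suc d)))"
    using n by (simp add: gauss_binom_def qpoch_Suc del: power_Suc)
  also have "\<dots> = qpoch q q n / ((qpoch q q k * (1 - q ^ Suc k)) * qpoch q q d)
      + q ^ Suc d * (qpoch q q n / (qpoch q q k * (qpoch q q d * (1 - q ^ Suc d))))"
    unfolding pow by (rule alg) (use nz in auto)
  also have "\<dots> = gauss_binom q n (Suc k) + q ^ (n - k) * gauss_binom q n k"
    using n by (simp add: gauss_binom_def qpoch_Suc del: power_Suc)
  finally show ?thesis .
next
  case False
  thus ?thesis using assms
    by (cases "k = n") (auto simp: gauss_binom_same gauss_binom_eq_0)
qed

text \<open>Both sides are the \<open>q\<close>-trinomial coefficient with parts \<open>k\<close>,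
  \<open>l\<close> and \<open>n - k - l\<close>, and both vanish when
  \<open>k + l > n\<close>.\<close>

lemma gauss_binom_mult_gauss_binom:
  assumes "norm q < 1"
  shows "gauss_binom q n k * gauss_binom q (n - k) l =
           gauss_binom q n (k + l) * gauss_binom q (k + l) l"
proof (cases "k + l \<le> n")
  case True
  have "n - k - l = n - (k + l)" by simp
  thus ?thesis using True qpoch_nonzero[OF assms]
    by (simp add: gauss_binom_def field_simps)
qed (auto simp: gauss_binom_def)

section \<open>The \<open>q\<close>-Vandermonde and \<open>q\<close>-Saalschuetz summations\<close>

text \<open>Induction on \<open>n\<close>, with the \<open>q\<close>-Pascal rule applied to the last
  factor. Truncation in \<open>m - c\<close> is harmless because \<open>gauss_binom q m c\<close> is
  zero for \<open>c > m\<close>.\<close>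

lemma gauss_binom_vandermonde:
  assumes "norm q < 1"
  shows "gauss_binom q (m + n) k =
    (\<Sum>c\<le>k. q ^ ((m - c) * (k - c)) * gauss_binom q m c * gauss_binom q n (k - c))"
proof (induction n arbitrary: k)
  case 0
  have "(\<Sum>c\<le>k. q ^ ((m - c) * (k - c)) * gauss_binom q m c * gauss_binom q 0 (k - c))
      = (\<Sum>c\<in>{k}. q ^ ((m - c) * (k - c)) * gauss_binom q m c * gauss_binom q 0 (k - c))"
    by (rule sum.mono_neutral_right) (auto simp: gauss_binom_eq_0)
  thus ?case using assms by (simp add: gauss_binom_0_right)
next
  case (Suc n)
  show ?case
  proof (cases k)
    case 0
    thus ?thesis using assms by (simp add: gauss_binom_0_right)
  next
    case (Suc k')
    let ?f = "\<lambda>n k c. q ^ ((m - c) * (k - c)) * gauss_binom q m c * gauss_binom q n (k - c)"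
    \<comment> \<open>The power produced by the Pascal rule combines with the old exponent into
      \<open>q ^ (m + n - k')\<close>, which is free of \<open>c\<close> and can leave the sum. With
      m = c + x, k' = c + y, n = y + z this is x*(y+1) + z = (x+z) + x*y.\<close>
    have step: "?f (Suc n) k c = ?f n k c + q ^ (m + n - k') * ?f n k' c" if "c \<le> k'" for c
    proof (cases "c \<le> m \<and> k' - c \<le> n")
      case True
      then obtain x y where x: "m = c + x" and y: "k' = c + y"
        using \<open>c \<le> k'\<close> le_Suc_ex by blast
      obtain z where z: "n = y + z" using True y le_Suc_ex by auto
      have "k - c = Suc (k' - c)" using that Suc by simp
      moreover have "m + n - k' = x + z" "n - y = z" using x y z by auto
      ultimately show ?thesis using x y Suc
        by (simp add: gauss_binom_Suc_Suc[OF assms] power_add algebra_simps)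
    next
      case False
      moreover have "k - c = Suc (k' - c)" using that Suc by simp
      ultimately show ?thesis by (auto simp: gauss_binom_Suc_Suc[OF assms] gauss_binom_eq_0)
    qed
    have "(\<Sum>c\<le>k. ?f (Suc n) k c) = (\<Sum>c\<le>k'. ?f (Suc n) k c) + ?f (Suc n) k k"
      using Suc by simp
    also have "\<dots> = (\<Sum>c\<le>k'. ?f n k c) + ?f n k k + q ^ (m + n - k') * (\<Sum>c\<le>k'. ?f n k' c)"
      using step assms by (simp add: sum.distrib sum_distrib_left gauss_binom_0_right)
    also have "\<dots> = (\<Sum>c\<le>k. ?f n k c) + q ^ (m + n - k') * (\<Sum>c\<le>k'. ?f n k' c)"
      using Suc by simp
    also have "\<dots> = gauss_binom q (m + n) k + q ^ (m + n - k') * gauss_binom q (m + n) k'"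
      using Suc.IH by simp
    also have "\<dots> = gauss_binom q (m + Suc n) k"
      using Suc by (simp add: gauss_binom_Suc_Suc[OF assms])
    finally show ?thesis by simp
  qed
qed

lemma gauss_binom_vandermonde':
  assumes "norm q < 1"
  shows "gauss_binom q (m + n) k =
    (\<Sum>c\<le>k. q ^ (c * (m + c - k)) * gauss_binom q n c * gauss_binom q m (k - c))"
  unfolding gauss_binom_vandermonde[OF assms]
  by (rule sum.reindex_bij_witness[of _ "\<lambda>c. k - c" "\<lambda>c. k - c"])
     (auto simp: mult_ac Nat.diff_diff_right add.commute)

text \<open>The form with all weights s*(s+j), in which the last sum of the Saalschuetz evaluation
  appears: terms with \<open>c > i\<close> vanish, and the rest are read backwards as c = i -
  s.\<close>

lemma gauss_binom_vandermonde_shifted: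
  assumes "norm q < 1"
  shows "gauss_binom q (A + i) (i + j) =
    (\<Sum>s\<le>i. q ^ (s * (s + j)) * gauss_binom q A (s + j) * gauss_binom q i s)"
proof -
  have "gauss_binom q (A + i) (i + j) =
      (\<Sum>c\<le>i+j. q ^ ((i - c) * (i + j - c)) * gauss_binom q i c * gauss_binom q A (i + j - c))"
    using gauss_binom_vandermonde[OF assms, of i A "i + j"] by (simp add: add.commute)
  also have "\<dots> =
      (\<Sum>c\<le>i. q ^ ((i - c) * (i + j - c)) * gauss_binom q i c * gauss_binom q A (i + j - c))"
    by (rule sum.mono_neutral_right) (auto simp: gauss_binom_eq_0)
  also have "\<dots> = (\<Sum>s\<le>i. q ^ (s * (s + j)) * gauss_binom q A (s + j) * gauss_binom q i s)"
    by (rule sum.reindex_bij_witness[of _ "\<lambda>c. i - c" "\<lambda>c. i - c"])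
       (auto simp: gauss_binom_symmetric mult_ac)
  finally show ?thesis .
qed

text \<open>
  Three applications of the \<open>q\<close>-Vandermonde identity: one splits the last factor on the left, summing
  over \<open>b\<close> for fixed \<open>s = b + c\<close> is the second, and the remaining sum over \<open>s\<close> is the third.
\<close>

lemma gauss_binom_saalschuetz:
  assumes "norm q < 1"
  shows "(\<Sum>b\<le>i. q ^ (b * (b + j)) * gauss_binom q A (b + j) * gauss_binom q B b
            * gauss_binom q (A + B + i - b) (A + B))
         = gauss_binom q (B + i + j) i * gauss_binom q (A + i) (i + j)"
proof -
  \<comment> \<open>The general term of the double sum, where \<open>c\<close> is the Vandermonde
    index from splitting the last binomial.\<close>
  define t where "t b c = q ^ (b * (b + j) + c * (B + j + b + c)) * gauss_binom q A (b + j)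
     * gauss_binom q (A - (b + j)) c * gauss_binom q B b * gauss_binom q (B + i + j) (i - b - c)" for b c
  have "(\<Sum>b\<le>i. q ^ (b * (b + j)) * gauss_binom q A (b + j) * gauss_binom q B b
            * gauss_binom q (A + B + i - b) (A + B)) = (\<Sum>b\<le>i. \<Sum>c\<le>i-b. t b c)"
  proof (intro sum.cong refl)
    fix b assume b: "b \<in> {..i}"
    show "q ^ (b * (b + j)) * gauss_binom q A (b + j) * gauss_binom q B b
            * gauss_binom q (A + B + i - b) (A + B) = (\<Sum>c\<le>i-b. t b c)"
    proof (cases "b + j \<le> A")
      case True
      have "gauss_binom q (A + B + i - b) (A + B) = gauss_binom q (A + B + i - b) (i - b)"
        using b gauss_binom_symmetric[of "i - b" "A + B + i - b"] by simp
      \<comment> \<open>This splitting of the top entry makes the second summand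
        \<open>A - (b + j)\<close>, so its binomial joins \<open>gauss_binom q A (b + j)\<close> in
        a trinomial.\<close>
      also have "\<dots> = gauss_binom q ((B + i + j) + (A - (b + j))) (i - b)"
        using True by (intro arg_cong2[of _ _ _ _ "gauss_binom q"]) auto
      also have "\<dots> = (\<Sum>c\<le>i-b. q ^ (c * (B + j + b + c))
          * gauss_binom q (A - (b + j)) c * gauss_binom q (B + i + j) (i - b - c))"
      proof (subst gauss_binom_vandermonde'[OF assms], intro sum.cong refl)
        fix c assume "c \<in> {..i - b}"
        hence "B + i + j + c - (i - b) = B + j + b + c" using b by auto
        thus "q ^ (c * (B + i + j + c - (i - b))) * gauss_binom q (A - (b + j)) c
            * gauss_binom q (B + i + j) (i - b - c) = q ^ (c * (B + j + b + c))
            * gauss_binom q (A - (b + j)) c * gauss_binom q (B + i + j) (i - b - c)" by simp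
      qed
      finally show ?thesis
        by (simp add: sum_distrib_left t_def power_add mult_ac)
    qed (simp add: gauss_binom_eq_0 t_def)
  qed
  also have "\<dots> = (\<Sum>s\<le>i. \<Sum>b\<le>s. t b (s - b))"
  proof -
    have "{(b, c). b + c \<le> i} = Sigma {..i} (\<lambda>b. {..i - b})" by auto
    thus ?thesis using sum.triangle_reindex_eq[of t i] by (simp add: sum.Sigma)
  qed
  also have "\<dots> = (\<Sum>s\<le>i. q ^ (s * (s + j)) * gauss_binom q A (s + j)
                  * (gauss_binom q (B + i + j) (i - s) * gauss_binom q (B + (s + j)) s))"
  proof (intro sum.cong refl)
    fix s assume s: "s \<in> {..i}"
    have "t b (s - b) = q ^ (s * (s + j)) * gauss_binom q A (s + j) * gauss_binom q (B + i + j) (i - s)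
        * (q ^ ((B - b) * (s - b)) * gauss_binom q B b * gauss_binom q (s + j) (s - b))"
      if "b \<le> s" for b
    proof (cases "b \<le> B")
      case True
      obtain d where d: "s = b + d" using \<open>b \<le> s\<close> le_Suc_ex by blast
      obtain e where e: "B = b + e" using True le_Suc_ex by blast
      \<comment> \<open>Once s = b + c is fixed, the exponent separates into a part depending on
        \<open>s\<close> only and the Vandermonde exponent for the sum over
        \<open>b\<close>.\<close>
      have "b * (b + j) + (s - b) * (B + j + b + (s - b)) = s * (s + j) + (B - b) * (s - b)"
        unfolding d e by (simp add: algebra_simps)
      hence pow: "q ^ (b * (b + j) + (s - b) * (B + j + b + (s - b)))
          = q ^ (s * (s + j)) * q ^ ((B - b) * (s - b))" by (simp add: power_add)
      have tri: "gauss_binom q A (b + j) * gauss_binom q (A - (b + j)) (s - b)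
          = gauss_binom q A (s + j) * gauss_binom q (s + j) (s - b)"
        using gauss_binom_mult_gauss_binom[OF assms, of A "b + j" "s - b"] that
        by (simp add: add.commute)
      have idx: "i - b - (s - b) = i - s" using that by simp
      show ?thesis unfolding t_def pow idx
        using arg_cong[OF tri, of "\<lambda>x. x * q ^ (s * (s + j)) * q ^ ((B - b) * (s - b))
           * gauss_binom q B b * gauss_binom q (B + i + j) (i - s)"] by (simp only: mult_ac)
    qed (simp add: gauss_binom_eq_0 t_def)
    thus "(\<Sum>b\<le>s. t b (s - b)) = q ^ (s * (s + j)) * gauss_binom q A (s + j)
                  * (gauss_binom q (B + i + j) (i - s) * gauss_binom q (B + (s + j)) s)"
      by (simp add: gauss_binom_vandermonde[OF assms, of B] sum_distrib_left mult.assoc)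
  qed
  \<comment> \<open>A second trinomial exchange frees one factor from \<open>s\<close> and leaves
    \<open>gauss_binom q i s\<close>, as the shifted Vandermonde sum requires.\<close>
  also have "\<dots> = (\<Sum>s\<le>i. q ^ (s * (s + j)) * gauss_binom q A (s + j)
                  * (gauss_binom q (B + i + j) i * gauss_binom q i s))"
  proof (rule sum.cong[OF refl], rule arg_cong[of _ _ "(*) _"])
    fix s assume "s \<in> {..i}"
    moreover from this have "B + i + j - (i - s) = B + (s + j)" by auto
    ultimately show "gauss_binom q (B + i + j) (i - s) * gauss_binom q (B + (s + j)) s
        = gauss_binom q (B + i + j) i * gauss_binom q i s"
      using gauss_binom_mult_gauss_binom[OF assms, of "B + i + j" "i - s" s]
      by (simp add: add_ac)
  qed
  also have "\<dots> = gauss_binom q (B + i + j) i * gauss_binom q (A + i) (i + j)"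
    by (simp add: gauss_binom_vandermonde_shifted[OF assms] sum_distrib_left mult_ac)
  finally show ?thesis .
qed

section \<open>The \<open>q\<close>-binomial theorem for polynomials\<close>

lemma qbinomial_theorem_poly:
  assumes "norm q < 1"
  shows "(\<Prod>k<N. [:1, z * q ^ k:]) =
    (\<Sum>k\<le>N. monom (z ^ k * q ^ (k choose 2) * gauss_binom q N k) k)"
proof -
  have coeff: "coeff (\<Prod>k<N. [:1, z * q ^ k:]) k = z ^ k * q ^ (k choose 2) * gauss_binom q N k" for k
  proof (induction N arbitrary: k)
    case 0
    show ?case using assms
      by (cases "k = 0") (auto simp: gauss_binom_eq_0 gauss_binom_same coeff_eq_0 numeral_2_eq_2)
  next
    case (Suc N)
    show ?case
    proof (cases k)
      case 0
      thus ?thesis using Suc[of 0] assms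
        by (simp add: gauss_binom_0_right coeff_mult_0 lessThan_Suc)
    next
      case (Suc k')
      \<comment> \<open>Of the power q^N, the part q^k' raises \<open>k' choose 2\<close> to
        \<open>k choose 2\<close>, and the remaining q^(N-k') is the weight in the Pascal
        rule.\<close>
      have pow: "q ^ N * gauss_binom q N k' = q ^ k' * (q ^ (N - k') * gauss_binom q N k')"
        by (cases "k' \<le> N") (auto simp: gauss_binom_eq_0 simp flip: power_add mult.assoc)
      have "coeff (\<Prod>k<Suc N. [:1, z * q ^ k:]) k
          = coeff (\<Prod>k<N. [:1, z * q ^ k:]) (Suc k') + z * q ^ N * coeff (\<Prod>k<N. [:1, z * q ^ k:]) k'"
        using Suc by (simp add: lessThan_Suc)
      also have "\<dots> = z ^ k * q ^ (k choose 2) * gauss_binom q N (Suc k')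
          + z ^ k * q ^ (k' choose 2) * (q ^ N * gauss_binom q N k')"
        using Suc by (simp add: Suc.IH mult_ac)
      also have "k choose 2 = (k' choose 2) + k'" using Suc by (simp add: numeral_2_eq_2)
      finally show ?thesis unfolding pow using Suc
        by (simp add: gauss_binom_Suc_Suc[OF assms] power_add algebra_simps numeral_2_eq_2)
    qed
  qed
  show ?thesis
    by (rule poly_eqI) (auto simp: coeff coeff_sum gauss_binom_eq_0)
qed

section \<open>Saalschuetz summation along the diagonals a - b = j\<close>

text \<open>The Saalschuetz summation with A = B = M. The integer \<open>i\<close> will be a halved
  difference that can be negative; in that case both sides are zero.\<close>

lemma sum_gauss_binom_int:
  fixes i :: int
  assumes "norm q < 1" "j \<le> M"
  shows "(\<Sum>b\<le>M. q ^ (b * (b + j)) * gauss_binom q M (b + j) * gauss_binom q M b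
            * qbinom q (2 * int M + i - int b) (2 * int M))
         = qbinom q (int M + int j + i) (int M + int j)
           * qbinom q (int M + i) (int M - int j)" (is "(\<Sum>b\<le>M. ?f b) = _")
proof (cases "i \<ge> 0")
  case True
  then obtain k where i: "i = int k" using nonneg_int_cases by blast
  have "(\<Sum>b\<le>M. ?f b) = (\<Sum>b\<le>k. ?f b)"
    by (rule sum.mono_neutral_cong) (auto simp: gauss_binom_eq_0 qbinom_eq_0 i)
  also have "\<dots> = (\<Sum>b\<le>k. q ^ (b * (b + j)) * gauss_binom q M (b + j) * gauss_binom q M b
            * gauss_binom q (M + M + k - b) (M + M))"
    by (intro sum.cong refl) (auto simp: i of_nat_diff simp flip: qbinom_int)
  also have "\<dots> = gauss_binom q (M + k + j) k * gauss_binom q (M + k) (k + j)"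
    by (rule gauss_binom_saalschuetz[OF assms(1)])
  also have "gauss_binom q (M + k + j) k = gauss_binom q (M + j + k) (M + j)"
    using gauss_binom_symmetric[of k "M + j + k" q] by (simp add: add_ac)
  also have "gauss_binom q (M + k) (k + j) = gauss_binom q (M + k) (M - j)"
    using gauss_binom_symmetric[of "k + j" "M + k" q] assms(2) by simp
  finally show ?thesis
    using assms(2) by (simp add: i of_nat_diff flip: qbinom_int)
qed (simp add: qbinom_eq_0)

text \<open>For negative \<open>j\<close> the roles of \<open>a\<close> and \<open>b\<close> are
  exchanged: b = a + d with d = -j replaces \<open>i\<close> by \<open>i + j\<close>, and the two
  factors on the right merely trade places.\<close>

lemma sum_gauss_binom_diagonal:
  fixes i j :: int
  assumes "norm q < 1" "\<bar>j\<bar> \<le> int M"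
  shows "(\<Sum>(a, b) | a \<le> M \<and> b \<le> M \<and> int a - int b = j.
            q ^ (a * b) * gauss_binom q M a * gauss_binom q M b
            * qbinom q (2 * int M + i - int b) (2 * int M))
         = qbinom q (int M + j + i) (int M + j) * qbinom q (int M - j + (i + j)) (int M - j)"
proof (cases "j \<ge> 0")
  case True
  then obtain d where j: "j = int d" using nonneg_int_cases by blast
  have "(\<Sum>(a, b) | a \<le> M \<and> b \<le> M \<and> int a - int b = j.
            q ^ (a * b) * gauss_binom q M a * gauss_binom q M b
            * qbinom q (2 * int M + i - int b) (2 * int M))
      = (\<Sum>b | b + d \<le> M. q ^ (b * (b + d)) * gauss_binom q M (b + d) * gauss_binom q M b
            * qbinom q (2 * int M + i - int b) (2 * int M))"
  proof (rule sum.reindex_bij_witness[of _ "\<lambda>b. (b + d, b)" snd])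
    fix p assume p: "p \<in> {(a, b). a \<le> M \<and> b \<le> M \<and> int a - int b = j}"
    then obtain b where "p = (b + d, b)"
      by (cases p) (auto simp: j)
    with p show "(snd p + d, snd p) = p" "snd p \<in> {b. b + d \<le> M}"
      "q ^ (snd p * (snd p + d)) * gauss_binom q M (snd p + d) * gauss_binom q M (snd p)
            * qbinom q (2 * int M + i - int (snd p)) (2 * int M)
       = (case p of (a, b) \<Rightarrow> q ^ (a * b) * gauss_binom q M a * gauss_binom q M b
            * qbinom q (2 * int M + i - int b) (2 * int M))"
      by (auto simp: mult_ac)
  qed (auto simp: j)
  also have "\<dots> = (\<Sum>b\<le>M. q ^ (b * (b + d)) * gauss_binom q M (b + d) * gauss_binom q M b
            * qbinom q (2 * int M + i - int b) (2 * int M))"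
    by (rule sum.mono_neutral_left) (auto simp: gauss_binom_eq_0)
  finally show ?thesis
    using sum_gauss_binom_int[OF assms(1), of d M i] assms(2) by (simp add: j add_ac)
next
  case False
  define d where "d = nat (- j)"
  have j: "j = - int d" using False by (simp add: d_def)
  have "(\<Sum>(a, b) | a \<le> M \<and> b \<le> M \<and> int a - int b = j.
            q ^ (a * b) * gauss_binom q M a * gauss_binom q M b
            * qbinom q (2 * int M + i - int b) (2 * int M))
      = (\<Sum>a | a + d \<le> M. q ^ (a * (a + d)) * gauss_binom q M (a + d) * gauss_binom q M a
            * qbinom q (2 * int M + (i - int d) - int a) (2 * int M))"
  proof (rule sum.reindex_bij_witness[of _ "\<lambda>a. (a, a + d)" fst])
    fix p assume p: "p \<in> {(a, b). a \<le> M \<and> b \<le> M \<and> int a - int b = j}"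
    then obtain a where "p = (a, a + d)"
      by (cases p) (auto simp: j)
    with p show "(fst p, fst p + d) = p" "fst p \<in> {a. a + d \<le> M}"
      "q ^ (fst p * (fst p + d)) * gauss_binom q M (fst p + d) * gauss_binom q M (fst p)
            * qbinom q (2 * int M + (i - int d) - int (fst p)) (2 * int M)
       = (case p of (a, b) \<Rightarrow> q ^ (a * b) * gauss_binom q M a * gauss_binom q M b
            * qbinom q (2 * int M + i - int b) (2 * int M))"
      by (auto simp: mult.commute diff_diff_eq add_diff_eq diff_add_eq add_ac)
  qed (auto simp: j)
  also have "\<dots> = (\<Sum>a\<le>M. q ^ (a * (a + d)) * gauss_binom q M (a + d) * gauss_binom q M a
            * qbinom q (2 * int M + (i - int d) - int a) (2 * int M))"
    by (rule sum.mono_neutral_left) (auto simp: gauss_binom_eq_0)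
  finally show ?thesis
    using sum_gauss_binom_int[OF assms(1), of d M "i - int d"] assms(2)
    by (simp add: j algebra_simps)
qed

section \<open>Weighted coefficient sums\<close>

text \<open>Moving the parity condition from the index set into the summand gives fixed finite
  ranges, so that sums can be interchanged.\<close>

lemma infsum_eq_sum_if:
  fixes f :: "'a \<Rightarrow> complex"
  assumes "finite B" "\<And>x. x \<in> A - B \<Longrightarrow> f x = 0"
  shows "infsum f A = (\<Sum>x\<in>B. if x \<in> A then f x else 0)"
proof -
  have "infsum f A = infsum (\<lambda>x. if x \<in> A then f x else 0) B"
    by (rule infsum_cong_neutral) (use assms in auto)
  thus ?thesis using assms(1) by simp
qed

lemma two_times_choose_two: "2 * int (n choose 2) = int n * int n - int n"
proof (induction n)
  case (Suc n)
  have "Suc n choose 2 = n + (n choose 2)" by (simp add: numeral_2_eq_2)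
  thus ?case using Suc by (simp add: algebra_simps)
qed simp

text \<open>The \<open>L\<close>-dependent weight of the left-hand sum, viewed as a linear
  functional on the coefficients of a polynomial.\<close>

definition parity_qbinom :: "complex \<Rightarrow> nat \<Rightarrow> nat \<Rightarrow> nat \<Rightarrow> complex" where
  "parity_qbinom Q L M m = (if [L = m] (mod 2)
     then qbinom Q (2 * int M + (int L - int m) div 2) (2 * int M) else 0)"

text \<open>With j = a - b one has n + a + b = n + j + 2*b, so \<open>b\<close> does not affect the
  parity and lowers the halved difference by exactly \<open>b\<close>.\<close>

lemma parity_qbinom_add:
  "parity_qbinom Q L M (n + a + b) =
     (if [int L - (int a - int b) = int n] (mod 2)
      then qbinom Q (2 * int M + (int L - (int a - int b) - int n) div 2 - int b) (2 * int M)
      else 0)"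
proof -
  have "[L = n + a + b] (mod 2) \<longleftrightarrow> [int L - (int a - int b) = int n] (mod 2)"
    by (simp flip: cong_int_iff add: cong_iff_dvd_diff) presburger
  moreover have "(int L - int (n + a + b)) div 2 = (int L - (int a - int b) - int n) div 2 - int b"
    by simp
  ultimately show ?thesis by (simp add: parity_qbinom_def add_diff_eq)
qed

text \<open>The coefficients \<open>u\<close> stay arbitrary because the two signs differ only in
  them; the other two products yield the sum over \<open>j\<close>.\<close>

lemma sum_coeff_mult_parity_qbinom:
  fixes q :: complex and L M :: nat and u :: "nat \<Rightarrow> complex"
  assumes "norm q < 1"
  defines "Q \<equiv> q ^ 6"
  defines "P \<equiv> (\<Sum>n\<le>M. monom (u n) n) * (\<Prod>k<M. [:1, q ^ 4 * Q ^ k:])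
                 * (\<Prod>k<M. [:1, q ^ 2 * Q ^ k:])"
  shows "(\<Sum>m\<le>3*M. coeff P m * parity_qbinom Q L M m) =
    (\<Sum>j\<in>{-int M..int M}. q powi (3 * j\<^sup>2 + j) * (\<Sum>n\<le>M. if [int L - j = int n] (mod 2)
        then u n * qbinom Q (int M + j + (int L - j - int n) div 2) (int M + j)
          * qbinom Q (int M - j + (int L + j - int n) div 2) (int M - j) else 0))"
proof -
  have Q: "norm Q < 1"
    using assms(1) by (simp add: Q_def norm_power power_less_one_iff)
  define v where "v a = (q ^ 4) ^ a * Q ^ (a choose 2) * gauss_binom Q M a" for a
  define w where "w b = (q ^ 2) ^ b * Q ^ (b choose 2) * gauss_binom Q M b" for b
  define H where "H = parity_qbinom Q L M"
  \<comment> \<open>The exponents satisfy 3*a^2 + a + 3*b^2 - b = 3*(a-b)^2 + (a-b) + 6*a*b. The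
    term 6*a*b leaves \<open>Q ^ (a * b)\<close>, the weight of the diagonal sum.\<close>
  have vw: "v a * w b = q powi (3 * j\<^sup>2 + j) * (Q ^ (a * b) * gauss_binom Q M a * gauss_binom Q M b)"
    if j: "j = int a - int b" for a b and j :: int
  proof -
    have "3 * j\<^sup>2 + j = 3 * (j * j) + j" by (simp add: power2_eq_square)
    moreover have "j * j + j \<ge> 0"
      using zero_le_mult_iff[of j "j + 1"] by (cases "j \<ge> 0") (auto simp: algebra_simps)
    \<comment> \<open>Nonnegativity turns \<open>powi\<close> into an ordinary power, which also
      covers q = 0.\<close>
    ultimately have nn: "3 * j\<^sup>2 + j \<ge> 0" using zero_le_square[of j] by linarith
    then obtain k where k: "3 * j\<^sup>2 + j = int k" using nonneg_int_cases by blast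
    have "int (4 * a + 6 * (a choose 2) + 2 * b + 6 * (b choose 2)) = int (k + 6 * (a * b))"
      using two_times_choose_two[of a] two_times_choose_two[of b] k[symmetric]
      by (simp add: j power2_eq_square algebra_simps)
    hence "4 * a + 6 * (a choose 2) + 2 * b + 6 * (b choose 2) = k + 6 * (a * b)"
      using of_nat_eq_iff by blast
    hence "q ^ (4 * a) * q ^ (6 * (a choose 2)) * q ^ (2 * b) * q ^ (6 * (b choose 2))
        = q ^ k * q ^ (6 * (a * b))" by (metis power_add)
    thus ?thesis
      unfolding v_def w_def Q_def k power_int_of_nat power_mult[symmetric]
      by (drule_tac arg_cong[of _ _ "\<lambda>x. x * (gauss_binom (q ^ 6) M a * gauss_binom (q ^ 6) M b)"])
         (simp only: mult_ac)
  qed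
  have P: "P = (\<Sum>n\<le>M. \<Sum>a\<le>M. \<Sum>b\<le>M. monom (u n * v a * w b) (n + a + b))"
    unfolding P_def qbinomial_theorem_poly[OF Q] v_def[symmetric] w_def[symmetric]
    by (subst sum_product, subst sum_distrib_right, subst sum_distrib_right)
       (simp only: sum_distrib_left mult_monom)
  have "(\<Sum>m\<le>3*M. coeff P m * H m)
      = (\<Sum>n\<le>M. \<Sum>a\<le>M. \<Sum>b\<le>M. \<Sum>m\<le>3*M. coeff (monom (u n * v a * w b) (n + a + b)) m * H m)"
    unfolding P coeff_sum sum_distrib_right
    by (subst sum.swap, rule sum.cong[OF refl])+ simp
  also have "\<dots> = (\<Sum>n\<le>M. \<Sum>a\<le>M. \<Sum>b\<le>M. u n * v a * w b * H (n + a + b))"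
    by (intro sum.cong refl) (simp add: if_distrib[of "\<lambda>x. x * _"] cong: if_cong)
  also have "\<dots> = (\<Sum>n\<le>M. \<Sum>(a, b)\<in>{..M}\<times>{..M}. u n * v a * w b * H (n + a + b))"
    by (simp add: sum.cartesian_product)
  \<comment> \<open>Pairs in the square are grouped by their difference, which lies between
    \<open>- int M\<close> and \<open>int M\<close>.\<close>
  also have "\<dots> = (\<Sum>n\<le>M. \<Sum>j\<in>{-int M..int M}. \<Sum>(a, b) | a \<le> M \<and> b \<le> M \<and> int a - int b = j.
                    u n * v a * w b * H (n + a + b))"
  proof (intro sum.cong refl)
    fix n
    have "(\<Sum>j\<in>{-int M..int M}. \<Sum>x | x \<in> {..M}\<times>{..M} \<and> int (fst x) - int (snd x) = j.
             case x of (a, b) \<Rightarrow> u n * v a * w b * H (n + a + b))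
        = (\<Sum>(a, b)\<in>{..M}\<times>{..M}. u n * v a * w b * H (n + a + b))"
      by (rule sum.group) auto
    moreover have "{x. x \<in> {..M}\<times>{..M} \<and> int (fst x) - int (snd x) = j}
        = {(a, b). a \<le> M \<and> b \<le> M \<and> int a - int b = j}" for j by auto
    ultimately show "(\<Sum>(a, b)\<in>{..M}\<times>{..M}. u n * v a * w b * H (n + a + b))
        = (\<Sum>j\<in>{-int M..int M}. \<Sum>(a, b) | a \<le> M \<and> b \<le> M \<and> int a - int b = j.
                    u n * v a * w b * H (n + a + b))" by simp
  qed
  also have "\<dots> = (\<Sum>n\<le>M. \<Sum>j\<in>{-int M..int M}. q powi (3 * j\<^sup>2 + j) *
      (if [int L - j = int n] (mod 2)
        then u n * qbinom Q (int M + j + (int L - j - int n) div 2) (int M + j)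
          * qbinom Q (int M - j + (int L + j - int n) div 2) (int M - j) else 0))"
  proof (intro sum.cong refl)
    fix n and j :: int
    assume j: "j \<in> {-int M..int M}"
    define i where "i = (int L - j - int n) div 2"
    have "(\<Sum>(a, b) | a \<le> M \<and> b \<le> M \<and> int a - int b = j. u n * v a * w b * H (n + a + b))
        = (\<Sum>(a, b) | a \<le> M \<and> b \<le> M \<and> int a - int b = j. q powi (3 * j\<^sup>2 + j) *
            (if [int L - j = int n] (mod 2) then u n *
              (Q ^ (a * b) * gauss_binom Q M a * gauss_binom Q M b
                * qbinom Q (2 * int M + i - int b) (2 * int M)) else 0))"
    proof (intro sum.cong refl, clarify)
      fix a b assume "j = int a - int b"
      show "u n * v a * w b * H (n + a + b) = q powi (3 * (int a - int b)\<^sup>2 + (int a - int b)) *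
            (if [int L - (int a - int b) = int n] (mod 2) then u n *
              (Q ^ (a * b) * gauss_binom Q M a * gauss_binom Q M b
                * qbinom Q (2 * int M + i - int b) (2 * int M)) else 0)"
        using vw[OF refl, of a b] \<open>j = int a - int b\<close>
        by (simp add: H_def parity_qbinom_add i_def mult_ac)
    qed
    also have "\<dots> = q powi (3 * j\<^sup>2 + j) * (if [int L - j = int n] (mod 2) then u n *
        (\<Sum>(a, b) | a \<le> M \<and> b \<le> M \<and> int a - int b = j.
              Q ^ (a * b) * gauss_binom Q M a * gauss_binom Q M b
                * qbinom Q (2 * int M + i - int b) (2 * int M)) else 0)"
      by (simp add: sum_distrib_left case_prod_unfold)
    also have "(\<Sum>(a, b) | a \<le> M \<and> b \<le> M \<and> int a - int b = j.
              Q ^ (a * b) * gauss_binom Q M a * gauss_binom Q M b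
                * qbinom Q (2 * int M + i - int b) (2 * int M))
        = qbinom Q (int M + j + i) (int M + j) * qbinom Q (int M - j + (i + j)) (int M - j)"
      by (rule sum_gauss_binom_diagonal[OF Q]) (use j in auto)
    also have "i + j = (int L + j - int n) div 2" unfolding i_def by simp
    finally show "(\<Sum>(a, b) | a \<le> M \<and> b \<le> M \<and> int a - int b = j. u n * v a * w b * H (n + a + b))
        = q powi (3 * j\<^sup>2 + j) * (if [int L - j = int n] (mod 2)
        then u n * qbinom Q (int M + j + (int L - j - int n) div 2) (int M + j)
          * qbinom Q (int M - j + (int L + j - int n) div 2) (int M - j) else 0)"
      by (simp add: i_def mult.assoc)
  qed
  finally show ?thesis
    unfolding H_def by (subst (asm) sum.swap) (simp add: sum_distrib_left)
qed

section \<open>Factors modulo 3 and both signs\<close>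

lemma prod_lessThan_triple:
  fixes f :: "nat \<Rightarrow> 'a :: comm_monoid_mult"
  shows "(\<Prod>k<3*M. f k) = (\<Prod>k<M. f (3*k)) * (\<Prod>k<M. f (3*k+1)) * (\<Prod>k<M. f (3*k+2))"
proof (induction M)
  case (Suc M)
  have "3 * Suc M = Suc (Suc (Suc (3 * M)))" by simp
  hence "(\<Prod>k<3*Suc M. f k) = (\<Prod>k<3*M. f k) * f (3*M) * f (3*M+1) * f (3*M+2)"
    by (simp only: prod.lessThan_Suc) simp
  thus ?case using Suc by (simp add: mult_ac)
qed simp

text \<open>The \<open>q\<close>-binomial theorem read backwards; the upper sign is z = 1 and the
  lower sign is z = q^2.\<close>

lemma infsum_qbinom_triple:
  fixes q z :: complex and L M :: nat
  assumes "norm q < 1"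
  shows "(\<Sum>\<^sub>\<infinity> m \<in> {m::nat. [L = m] (mod 2)}. z ^ m * (q ^ 2) ^ (m choose 2)
        * qbinom (q ^ 2) (3 * int M) (int m)
        * qbinom (q ^ 6) (2 * int M + (int L - int m) div 2) (2 * int M))
    = (\<Sum>m\<le>3*M. coeff (\<Prod>k<3*M. [:1, z * (q ^ 2) ^ k:]) m * parity_qbinom (q ^ 6) L M m)"
proof -
  have q2: "norm (q ^ 2) < 1"
    using assms by (simp add: norm_power power_less_one_iff)
  have c: "coeff (\<Prod>k<3*M. [:1, z * (q ^ 2) ^ k:]) m
      = z ^ m * (q ^ 2) ^ (m choose 2) * qbinom (q ^ 2) (3 * int M) (int m)" if "m \<le> 3 * M" for m
    using that qbinom_int[of "q ^ 2" "3 * M" m]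
    by (simp add: qbinomial_theorem_poly[OF q2] coeff_sum)
  show ?thesis
    by (subst infsum_eq_sum_if[of "{..3*M}"])
       (auto simp: qbinom_eq_0 c parity_qbinom_def intro!: sum.cong)
qed

theorem theorem7p1:
  fixes q :: complex and L M :: nat
  assumes "norm q < 1"
  shows
    "(\<Sum>\<^sub>\<infinity> m \<in> {m::nat. [L = m] (mod 2)}.
        q powi ((int m)\<^sup>2 - int m)
        * qbinom (q ^ 2) (3 * int M) (int m)
        * qbinom (q ^ 6) (2 * int M + (int L - int m) div 2) (2 * int M))
     = (\<Sum>\<^sub>\<infinity> j::int. q powi (3 * j\<^sup>2 + j) * T_plus (int L) (int M) j j (q ^ 6))
   \<and> (\<Sum>\<^sub>\<infinity> m \<in> {m::nat. [L = m] (mod 2)}.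
        q powi ((int m)\<^sup>2 + int m)
        * qbinom (q ^ 2) (3 * int M) (int m)
        * qbinom (q ^ 6) (2 * int M + (int L - int m) div 2) (2 * int M))
     = (\<Sum>\<^sub>\<infinity> j::int. q powi (3 * j\<^sup>2 + j) * T_minus (int L) (int M) j j (q ^ 6))"
proof -
  have Q: "norm (q ^ 6) < 1"
    using assms by (simp add: norm_power power_less_one_iff)
  \<comment> \<open>The trivial factor \<open>1 ^ m\<close> makes the term an instance of the common
    form with z = 1.\<close>
  have pow_minus: "q powi ((int m)\<^sup>2 - int m) = 1 ^ m * (q ^ 2) ^ (m choose 2)" for m
    using two_times_choose_two[of m] power_int_of_nat[of q "2 * (m choose 2)"]
    by (simp only: power2_eq_square power_mult power_one mult_1_left of_nat_mult of_nat_numeral)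
  have pow_plus: "q powi ((int m)\<^sup>2 + int m) = (q ^ 2) ^ m * (q ^ 2) ^ (m choose 2)" for m
  proof -
    have "(int m)\<^sup>2 + int m = int (2 * m + 2 * (m choose 2))"
      using two_times_choose_two[of m] by (simp add: power2_eq_square)
    thus ?thesis by (simp only: power_int_of_nat power_add power_mult)
  qed
  have choose_Suc: "(n + 1) choose 2 = n + (n choose 2)" for n
    by (simp add: numeral_2_eq_2)

  have "(q ^ 2) ^ (3 * k) = (q ^ 6) ^ k" for k
    by (simp flip: power_mult)
  hence pow_triple: "(q ^ 2) ^ (3 * k) = (q ^ 6) ^ k" "(q ^ 2) ^ (3 * k + 1) = q ^ 2 * (q ^ 6) ^ k"
    "(q ^ 2) ^ (3 * k + 2) = q ^ 4 * (q ^ 6) ^ k" for k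
    by (simp_all only: power_add mult.commute) (simp_all flip: power_mult)
  \<comment> \<open>The residue class 0 has leading power 1 and becomes the sum over
    \<open>n\<close>; classes 1 and 2 give the factors with q^2 and q^4.\<close>
  have plus: "(\<Prod>k<3*M. [:1, 1 * (q ^ 2) ^ k:]) =
     (\<Sum>n\<le>M. monom ((q ^ 6) ^ (n choose 2) * qbinom (q ^ 6) (int M) (int n)) n)
       * (\<Prod>k<M. [:1, q ^ 4 * (q ^ 6) ^ k:]) * (\<Prod>k<M. [:1, q ^ 2 * (q ^ 6) ^ k:])"
  proof -
    have "(\<Sum>n\<le>M. monom ((q ^ 6) ^ (n choose 2) * qbinom (q ^ 6) (int M) (int n)) n)
        = (\<Prod>k<M. [:1, (q ^ 6) ^ k:])"
      using qbinomial_theorem_poly[OF Q, where N = M and z = 1] by (simp add: qbinom_int)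
    thus ?thesis
      unfolding prod_lessThan_triple pow_triple by (simp add: mult_ac flip: power_add)
  qed
  \<comment> \<open>The extra q^2 shifts the leading powers to q^2, q^4, q^6. The first two products
    are the same as before, while the third carries an additional Q^n with Q = q^6, turning
    \<open>n choose 2\<close> into \<open>(n + 1) choose 2\<close>.\<close>
  have minus: "(\<Prod>k<3*M. [:1, q ^ 2 * (q ^ 2) ^ k:]) =
     (\<Sum>n\<le>M. monom ((q ^ 6) ^ ((n + 1) choose 2) * qbinom (q ^ 6) (int M) (int n)) n)
       * (\<Prod>k<M. [:1, q ^ 4 * (q ^ 6) ^ k:]) * (\<Prod>k<M. [:1, q ^ 2 * (q ^ 6) ^ k:])"
  proof -
    have "(\<Sum>n\<le>M. monom ((q ^ 6) ^ ((n + 1) choose 2) * qbinom (q ^ 6) (int M) (int n)) n)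
        = (\<Prod>k<M. [:1, q ^ 6 * (q ^ 6) ^ k:])"
      unfolding choose_Suc power_add qbinom_int
      by (rule qbinomial_theorem_poly[OF Q, symmetric])
    thus ?thesis
      unfolding prod_lessThan_triple pow_triple by (simp add: mult_ac flip: power_add)
  qed

  have T_plus: "T_plus (int L) (int M) j j (q ^ 6) =
     (\<Sum>n\<le>M. if [int L - j = int n] (mod 2)
        then (q ^ 6) ^ (n choose 2) * qbinom (q ^ 6) (int M) (int n)
          * qbinom (q ^ 6) (int M + j + (int L - j - int n) div 2) (int M + j)
          * qbinom (q ^ 6) (int M - j + (int L + j - int n) div 2) (int M - j) else 0)" for j
    unfolding T_plus_def by (subst infsum_eq_sum_if[of "{..M}"]) (auto simp: qbinom_eq_0)
  have T_minus: "T_minus (int L) (int M) j j (q ^ 6) =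
     (\<Sum>n\<le>M. if [int L - j = int n] (mod 2)
        then (q ^ 6) ^ ((n + 1) choose 2) * qbinom (q ^ 6) (int M) (int n)
          * qbinom (q ^ 6) (int M + j + (int L - j - int n) div 2) (int M + j)
          * qbinom (q ^ 6) (int M - j + (int L + j - int n) div 2) (int M - j) else 0)" for j
    unfolding T_minus_def by (subst infsum_eq_sum_if[of "{..M}"]) (auto simp: qbinom_eq_0)

  have inf_plus: "(\<Sum>\<^sub>\<infinity> j::int. q powi (3 * j\<^sup>2 + j) * T_plus (int L) (int M) j j (q ^ 6))
      = (\<Sum>j\<in>{-int M..int M}. q powi (3 * j\<^sup>2 + j) * T_plus (int L) (int M) j j (q ^ 6))"
    by (subst infsum_eq_sum_if[of "{-int M..int M}"]) (auto intro!: T_plus_support)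
  have inf_minus: "(\<Sum>\<^sub>\<infinity> j::int. q powi (3 * j\<^sup>2 + j) * T_minus (int L) (int M) j j (q ^ 6))
      = (\<Sum>j\<in>{-int M..int M}. q powi (3 * j\<^sup>2 + j) * T_minus (int L) (int M) j j (q ^ 6))"
    by (subst infsum_eq_sum_if[of "{-int M..int M}"]) (auto intro!: T_minus_support)

  show ?thesis
    unfolding inf_plus inf_minus
    unfolding pow_minus pow_plus infsum_qbinom_triple[OF assms] plus minus
      sum_coeff_mult_parity_qbinom[OF assms] T_plus T_minus
    by simp
qed

end
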